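(* Let $p\ge2$ and let $m_1,\dots,m_p$ be positive integers. Two points $P_1=(x_1,\dots,x_p)$ and $P_2=(y_1,\dots,y_p)$ of $\mathcal{S}^p$ lie in the same orbit if and only if $I(P_1)=I(P_2)$.
   Context: $\mathcal{S}^p=\{(x_1,\dots,x_p)\in\mathbb{Z}^p: 0\le x_i\le m_i\}$. A diagonal move takes $P\in\mathcal{S}^p$ to $Q\in\mathcal{S}^p$ with $Q-P\in\{\pm1\}^p$ (along a main diagonal of a unit cube); two points lie in the same orbit if one can be reached from the other by a finite sequence of diagonal moves (equivalently, orbits of the group generated by the maps $(x_1,\dots,x_p)\mapsto(\varphi_{m_1}(x_1\pm1),\dots,\varphi_{m_p}(x_p\pm1))$ with independent signs, where $\varphi_m(u)=\min_{n\in\mathbb{Z}}|u-2nm|$). For an integer $a$, $[a]_2\in\{0,1\}$ denotes its residue mod $2$. The index of $P=(x_1,\dots,x_p)$ is $I(P)=([x_1+x_2]_2,[x_1+x_3]_2,\dots,[x_1+x_p]_2)$. *)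

theory Defs
  imports Main "HOL-Library.FuncSet"
begin

text \<open>
  Points of \<open>\<int>\<^sup>p\<close> are functions on \<open>{1..p}\<close> in the sense of \<^term>\<open>PiE\<close>: coordinates are indexed
  from 1, and a point is \<^term>\<open>undefined\<close> outside \<open>{1..p}\<close>, so equality of points is equality of
  coordinates.
\<close>

definition grid :: "nat \<Rightarrow> (nat \<Rightarrow> int) \<Rightarrow> (nat \<Rightarrow> int) set" where
  "grid p m = (\<Pi>\<^sub>E i\<in>{1..p}. {0..m i})"

definition diagonal_move :: "nat \<Rightarrow> (nat \<Rightarrow> int) \<Rightarrow> (nat \<Rightarrow> int) \<Rightarrow> (nat \<Rightarrow> int) \<Rightarrow> bool" where
  "diagonal_move p m P Q \<longleftrightarrow>
     P \<in> grid p m \<and> Q \<in> grid p m \<and> (\<forall>i\<in>{1..p}. Q i - P i \<in> {-1, 1})"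

definition same_orbit :: "nat \<Rightarrow> (nat \<Rightarrow> int) \<Rightarrow> (nat \<Rightarrow> int) \<Rightarrow> (nat \<Rightarrow> int) \<Rightarrow> bool" where
  "same_orbit p m P Q \<longleftrightarrow> (diagonal_move p m)\<^sup>*\<^sup>* P Q"

text \<open>Moves are reversible, so it does not matter which of the two points is reached from the other.\<close>

lemma diagonal_move_sym: "diagonal_move p m P Q \<Longrightarrow> diagonal_move p m Q P"
  unfolding diagonal_move_def by force

lemma same_orbit_sym: "same_orbit p m P Q \<Longrightarrow> same_orbit p m Q P"
  unfolding same_orbit_def
  by (rule sympD[OF symp_rtranclp]) (auto intro: sympI diagonal_move_sym)

definition index :: "nat \<Rightarrow> (nat \<Rightarrow> int) \<Rightarrow> int list" where
  "index p P = map (\<lambda>i. (P 1 + P i) mod 2) [2..<Suc p]"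

end

theory Submission
  imports Defs
begin

text \<open>
  A diagonal move changes the parity of every coordinate, so it preserves the index. Conversely,
  equal indices mean that all the differences \<open>y\<^sub>i - x\<^sub>i\<close> have the same parity. Choose \<open>N\<close> of that
  parity with \<open>\<bar>y\<^sub>i - x\<^sub>i\<bar> \<le> N\<close> for all \<open>i\<close>; then \<open>y\<close> is reached from \<open>x\<close> in exactly \<open>N\<close> moves, each
  coordinate walking towards its target and oscillating next to it once it has arrived.
\<close>

lemma diagonal_move_index:
  assumes "p \<ge> 1" and "diagonal_move p m P Q"
  shows "index p P = index p Q"
proof -
  have odd: "odd (Q i - P i)" if "i \<in> {1..p}" for i
    using assms(2) that unfolding diagonal_move_def by fastforce
  have "(P 1 + P i) mod 2 = (Q 1 + Q i) mod 2" if "i \<in> {1..p}" for i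
    using odd[of 1] odd[OF that] assms(1) by simp presburger
  then show ?thesis
    by (auto simp: index_def)
qed

lemma same_orbit_index:
  assumes "p \<ge> 1" and "same_orbit p m P Q"
  shows "index p P = index p Q"
  using assms(2) unfolding same_orbit_def
  by (induction rule: rtranclp_induct) (simp_all add: diagonal_move_index[OF assms(1)])

text \<open>The argument \<open>k\<close> matters only at the target \<open>u = t\<close>: the walk
  then oscillates upwards, except at the upper wall \<open>t = k\<close>, where it turns
  down.\<close>

definition step_towards :: "int \<Rightarrow> int \<Rightarrow> int \<Rightarrow> int" where
  "step_towards k t u = (if u < t \<or> u = t \<and> u < k then u + 1 else u - 1)"

lemma step_towards_diff: "step_towards k t u - u \<in> {-1, 1}"
  by (simp add: step_towards_def)

lemma step_towards_mem:
  assumes "0 < k" "t \<in> {0..k}" "u \<in> {0..k}"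
  shows "step_towards k t u \<in> {0..k}"
  using assms by (auto simp: step_towards_def)

lemma dist_step_towards:
  assumes "\<bar>t - u\<bar> \<le> int (Suc N)" "even (t - u - int (Suc N))"
  shows "\<bar>t - step_towards k t u\<bar> \<le> int N" "even (t - step_towards k t u - int N)"
proof -
  \<comment> \<open>At the target the next step creates distance 1. Parity makes
    \<open>Suc N\<close> even there, so at least one further move remains to undo it.\<close>
  have "N \<noteq> 0" if "t = u"
    using assms(2) that by (cases N) simp_all
  then show "\<bar>t - step_towards k t u\<bar> \<le> int N"
    using assms(1) by (cases "t = u") (auto simp: step_towards_def)
  show "even (t - step_towards k t u - int N)"
    using assms(2) by (auto simp: step_towards_def)
qed

text \<open>Each move shifts all coordinates at once, so they must arrive simultaneously; a common
  \<open>N\<close> of the right parity ensures this. Induction on \<open>N\<close>, the number of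
  moves left.\<close>

lemma same_orbit_if_dist_le:
  assumes "\<And>i. i \<in> {1..p} \<Longrightarrow> m i > 0" "y \<in> grid p m" "x \<in> grid p m"
    and "\<And>i. i \<in> {1..p} \<Longrightarrow> \<bar>y i - x i\<bar> \<le> int N"
    and "\<And>i. i \<in> {1..p} \<Longrightarrow> even (y i - x i - int N)"
  shows "same_orbit p m x y"
  using assms(3-)
proof (induction N arbitrary: x)
  case 0
  have "x = y"
  proof (rule PiE_ext)
    show "x \<in> (\<Pi>\<^sub>E i\<in>{1..p}. {0..m i})" "y \<in> (\<Pi>\<^sub>E i\<in>{1..p}. {0..m i})"
      using 0(1) assms(2) by (simp_all only: grid_def)
    show "x i = y i" if "i \<in> {1..p}" for i
      using 0(2)[OF that] by simp
  qed
  then show ?case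
    by (simp add: same_orbit_def)
next
  case (Suc N)
  define z where "z = (\<lambda>i\<in>{1..p}. step_towards (m i) (y i) (x i))"
  have z: "z i = step_towards (m i) (y i) (x i)" if "i \<in> {1..p}" for i
    using that by (simp add: z_def)
  have z_grid: "z \<in> grid p m"
    using assms(1,2) Suc.prems(1) unfolding grid_def z_def
    by (intro restrict_PiE_iff[THEN iffD2] ballI step_towards_mem) (auto dest: PiE_mem)
  have "diagonal_move p m x z"
    unfolding diagonal_move_def using Suc.prems(1) z_grid
    by (intro conjI ballI) (simp_all only: z step_towards_diff)
  moreover have "same_orbit p m z y"
  proof (rule Suc.IH[OF z_grid])
    fix i assume i: "i \<in> {1..p}"
    show "\<bar>y i - z i\<bar> \<le> int N" "even (y i - z i - int N)"
      unfolding z[OF i] using Suc.prems(2,3)[OF i] by (fact dist_step_towards)+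
  qed
  ultimately show ?case
    unfolding same_orbit_def by (rule converse_rtranclp_into_rtranclp)
qed

lemma index_eq_imp_even_diff:
  assumes "index p x = index p y" "i \<in> {1..p}"
  shows "even (y i - x i - (y 1 - x 1))"
proof (cases "i = 1")
  case False
  then have "(x 1 + x i) mod 2 = (y 1 + y i) mod 2"
    using assms unfolding index_def map_eq_conv by (elim ballE[of _ _ i]) simp_all
  then show ?thesis
    by presburger
qed simp

theorem theorem4p17:
  fixes p :: nat and m x y :: "nat \<Rightarrow> int"
  assumes "p \<ge> 2"
    and "\<And>i. i \<in> {1..p} \<Longrightarrow> m i > 0"
    and "x \<in> grid p m" and "y \<in> grid p m"
  shows "same_orbit p m x y \<longleftrightarrow> index p x = index p y"
proof
  assume "same_orbit p m x y"
  then show "index p x = index p y"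
    using assms(1) by (intro same_orbit_index) auto
next
  assume index: "index p x = index p y"
  define S where "S = (\<Sum>i\<in>{1..p}. \<bar>y i - x i\<bar>)"
  \<comment> \<open>The first summand fixes the parity, the one shared by all differences; adding
    \<open>S\<close> twice keeps it and makes \<open>N\<close> dominate every distance.\<close>
  define N where "N = nat (\<bar>y 1 - x 1\<bar> + 2 * S)"
  have "S \<ge> 0"
    by (simp add: S_def sum_nonneg)
  then have N: "int N = \<bar>y 1 - x 1\<bar> + 2 * S"
    by (simp add: N_def)
  show "same_orbit p m x y"
  proof (rule same_orbit_if_dist_le[OF assms(2,4,3)])
    fix i assume i: "i \<in> {1..p}"
    have "\<bar>y i - x i\<bar> \<le> S"
      unfolding S_def using i by (intro member_le_sum) auto
    then show "\<bar>y i - x i\<bar> \<le> int N"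
      using N \<open>S \<ge> 0\<close> by linarith
    show "even (y i - x i - int N)"
      using index_eq_imp_even_diff[OF index i] unfolding N by presburger
  qed
qed

end
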